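(* Let $G$ and $H$ be connected graphs, each with at least two vertices. Then the visibility polynomial $\mathcal{V}(G\odot H)$ is a monic polynomial.
   Context: All graphs are finite, simple, undirected and connected. For a graph $G$ and $X \subseteq V(G)$, two vertices $u,v$ are $X$-visible if there exists a shortest $(u,v)$-path $P$ in $G$ with $V(P)\cap X \subseteq \{u,v\}$. A set $X\subseteq V(G)$ is a mutual-visibility set of $G$ if every two vertices of $X$ are $X$-visible (the empty set counts). The visibility polynomial of $G$ is $\mathcal{V}(G)=\sum_{i\ge 0} r_i x^i$, where $r_i$ is the number of mutual-visibility sets of $G$ of cardinality $i$. The corona $G\odot H$ is obtained from one copy of $G$ and $|V(G)|$ copies of $H$, the copy associated with $v\in V(G)$ being denoted $H_v$, by joining each $v \in V(G)$ to every vertex of $H_v$. *)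

theory Defs
  imports
    "Graph_Theory.Graph_Theory"
    "HOL-Computational_Algebra.Polynomial"
begin

text \<open>
  Finite simple undirected graphs are values of type \<^typ>\<open>'a pair_pre_digraph\<close> satisfying
  \<^locale>\<open>pair_graph\<close> (each edge is present as two opposite arcs); a \<^const>\<open>vpath\<close> is the
  non-empty list of pairwise distinct vertices of a path.
\<close>

definition shortest_vpath :: "('a, 'b) pre_digraph \<Rightarrow> 'a \<Rightarrow> 'a vwalk \<Rightarrow> 'a \<Rightarrow> bool" where
  "shortest_vpath G u p v \<longleftrightarrow>
     vpath p G \<and> hd p = u \<and> last p = v \<and>
     (\<forall>q. vpath q G \<and> hd q = u \<and> last q = v \<longrightarrow> vwalk_length p \<le> vwalk_length q)"

definition visible :: "('a, 'b) pre_digraph \<Rightarrow> 'a set \<Rightarrow> 'a \<Rightarrow> 'a \<Rightarrow> bool" where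
  "visible G X u v \<longleftrightarrow> (\<exists>p. shortest_vpath G u p v \<and> set p \<inter> X \<subseteq> {u, v})"

definition mutual_visibility_set :: "('a, 'b) pre_digraph \<Rightarrow> 'a set \<Rightarrow> bool" where
  "mutual_visibility_set G X \<longleftrightarrow>
     X \<subseteq> verts G \<and> (\<forall>u\<in>X. \<forall>v\<in>X. u \<noteq> v \<longrightarrow> visible G X u v)"

definition mv_count :: "('a, 'b) pre_digraph \<Rightarrow> nat \<Rightarrow> nat" where
  "mv_count G i = card {X. mutual_visibility_set G X \<and> card X = i}"

definition visibility_poly :: "('a, 'b) pre_digraph \<Rightarrow> int poly" where
  "visibility_poly G = (\<Sum>i\<le>card (verts G). monom (int (mv_count G i)) i)"

text \<open>
  No mutual-visibility set has more than \<open>card (verts G)\<close> elements, so truncating the sum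
  loses no coefficient.
\<close>

lemma coeff_visibility_poly:
  assumes "finite (verts G)"
  shows "coeff (visibility_poly G) i = int (mv_count G i)"
proof (cases "i \<le> card (verts G)")
  case True
  then show ?thesis
    by (simp add: visibility_poly_def coeff_sum)
next
  case False
  then have "{X. mutual_visibility_set G X \<and> card X = i} = {}"
    using assms by (auto simp: mutual_visibility_set_def dest: card_mono)
  then have "mv_count G i = 0"
    by (simp only: mv_count_def card.empty)
  with False show ?thesis
    by (simp add: visibility_poly_def coeff_sum)
qed

text \<open>
  In the corona, \<open>Inl v\<close> is the vertex \<open>v\<close> of \<open>G\<close> and \<open>Inr (v, x)\<close> is the vertex \<open>x\<close> of
  the copy of \<open>H\<close> associated with \<open>v\<close>.
\<close>

definition corona ::
    "'a pair_pre_digraph \<Rightarrow> 'b pair_pre_digraph \<Rightarrow> ('a + 'a \<times> 'b) pair_pre_digraph" where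
  "corona G H =
     \<lparr> pverts = pverts G <+> pverts G \<times> pverts H,
       parcs =
         {(Inl u, Inl v) | u v. (u, v) \<in> parcs G} \<union>
         {(Inr (v, x), Inr (v, y)) | v x y. v \<in> pverts G \<and> (x, y) \<in> parcs H} \<union>
         {(Inl v, Inr (v, x)) | v x. v \<in> pverts G \<and> x \<in> pverts H} \<union>
         {(Inr (v, x), Inl v) | v x. v \<in> pverts G \<and> x \<in> pverts H} \<rparr>"

lemma pair_graph_corona:
  assumes "pair_graph G" and "pair_graph H"
  shows "pair_graph (corona G H)"
proof -
  interpret G: pair_graph G by fact
  interpret H: pair_graph H by fact
  let ?C = "corona G H"
  have fin: "finite (pverts ?C)"
    by (simp add: corona_def G.pair_finite_verts H.pair_finite_verts)
  have wf: "fst e \<in> pverts ?C" "snd e \<in> pverts ?C" if "e \<in> parcs ?C" for e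
    using that by (auto simp: corona_def dest: G.wellformed' H.wellformed')
  have "parcs ?C \<subseteq> pverts ?C \<times> pverts ?C"
    using wf by (auto simp: mem_Times_iff)
  with fin have fin_arcs: "finite (parcs ?C)"
    by (meson finite_SigmaI finite_subset)
  have "sym (parcs G)" "sym (parcs H)"
    using G.pair_sym_arcs H.pair_sym_arcs by (simp_all add: symmetric_def)
  then have sym: "symmetric (with_proj ?C)"
    unfolding symmetric_def with_proj_simps corona_def by (auto simp: sym_def)
  have loop: "fst e \<noteq> snd e" if "e \<in> parcs ?C" for e
    using that by (auto simp: corona_def dest: G.pair_no_loops H.pair_no_loops)
  show ?thesis
    by unfold_locales (use fin wf fin_arcs sym loop in auto)
qed

end

theory Submission
  imports Defs
begin

text \<open>
  The unique largest mutual-visibility set of the corona consists of all vertices of all copies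
  of \<open>H\<close>: two of them in the copies at \<open>v \<noteq> w\<close> see each other along a shortest path from \<open>v\<close>
  to \<open>w\<close> in \<open>G\<close>. A mutual-visibility set containing a vertex \<open>v\<close> of \<open>G\<close>, which is a cut vertex
  separating its copy of \<open>H\<close>, either avoids that copy or lies in that copy plus \<open>v\<close>; since \<open>H\<close>
  and \<open>G\<close> have at least two vertices, both alternatives make it strictly smaller.
\<close>

section \<open>Shortest paths among all walks\<close>

lemma length_vwalk_to_vpath_le: "length (vwalk_to_vpath p) \<le> length p"
proof (induct p rule: vwalk_to_vpath_induct3)
  case (in_set x xs)
  then show ?case
    using length_dropWhile_le[of "\<lambda>y. y \<noteq> x" xs] by simp
qed auto

text \<open>A walk of minimal length stays minimal when its cycles are cut out. Minimality is stated
  against walks, not only paths, because projecting a path of the corona to \<open>G\<close> yields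
  just a walk.\<close>

lemma shortest_vpath_exists:
  assumes "vwalk p G" "hd p = u" "last p = v"
  obtains q where "vpath q G" "hd q = u" "last q = v"
    "\<And>r. vwalk r G \<Longrightarrow> hd r = u \<Longrightarrow> last r = v \<Longrightarrow> length q \<le> length r"
proof -
  let ?P = "\<lambda>p. vwalk p G \<and> hd p = u \<and> last p = v"
  define q where "q = arg_min length ?P"
  have q: "?P q" and q_min: "\<And>r. ?P r \<Longrightarrow> length q \<le> length r"
    using assms arg_min_nat_lemma[of ?P p length] by (auto simp: q_def)
  show thesis
  proof
    show "vpath (vwalk_to_vpath q) G" "hd (vwalk_to_vpath q) = u" "last (vwalk_to_vpath q) = v"
      using q by (auto simp: vwalk_to_vpath_vpath vwalk_to_vpath_hd vwalk_to_vpath_last)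
    show "length (vwalk_to_vpath q) \<le> length r" if "vwalk r G" "hd r = u" "last r = v" for r
      using q_min[of r] that length_vwalk_to_vpath_le[of q] by simp
  qed
qed

section \<open>Walks in the corona\<close>

lemma pverts_corona: "pverts (corona G H) = Inl ` pverts G \<union> Inr ` (pverts G \<times> pverts H)"
  by (auto simp: corona_def)

lemma parcs_corona_iff [simp]:
  "(Inl u, Inl v) \<in> parcs (corona G H) \<longleftrightarrow> (u, v) \<in> parcs G"
  "(Inr (v, x), Inr (w, y)) \<in> parcs (corona G H) \<longleftrightarrow> v = w \<and> v \<in> pverts G \<and> (x, y) \<in> parcs H"
  "(Inl v, Inr (w, x)) \<in> parcs (corona G H) \<longleftrightarrow> v = w \<and> v \<in> pverts G \<and> x \<in> pverts H"
  "(Inr (w, x), Inl v) \<in> parcs (corona G H) \<longleftrightarrow> v = w \<and> v \<in> pverts G \<and> x \<in> pverts H"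
  by (auto simp: corona_def)

text \<open>Sending each copy to its vertex of \<open>G\<close> and merging repetitions turns a
  corona walk into a walk in \<open>G\<close>. Here \<open>length\<close> counts vertices: the end
  inside the copy at \<open>w\<close> costs one extra vertex, and a start inside another copy costs
  a second one. The guard \<open>v \<noteq> w\<close> is essential, since a walk may stay within a
  single copy.\<close>

lemma vwalk_corona_project:
  assumes "vwalk q (with_proj (corona G H))" "last q = Inr (w, y)" "pair_graph G"
  shows "case hd q of
      Inl v \<Rightarrow> \<exists>r. vwalk r (with_proj G) \<and> hd r = v \<and> last r = w \<and> length r + 1 \<le> length q
    | Inr (v, x) \<Rightarrow> v \<noteq> w \<longrightarrow>
        (\<exists>r. vwalk r (with_proj G) \<and> hd r = v \<and> last r = w \<and> length r + 2 \<le> length q)"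
  using assms(1,2)
proof (induct q)
  case (Base a)
  then show ?case by auto
next
  case (Cons a b q)
  interpret G: pair_graph G by fact
  have arc: "(a, b) \<in> parcs (corona G H)"
    using Cons by simp
  have IH: "case b of
      Inl v \<Rightarrow> \<exists>r. vwalk r (with_proj G) \<and> hd r = v \<and> last r = w \<and> length r + 1 \<le> length (b # q)
    | Inr (v, x) \<Rightarrow> v \<noteq> w \<longrightarrow>
        (\<exists>r. vwalk r (with_proj G) \<and> hd r = v \<and> last r = w \<and> length r + 2 \<le> length (b # q))"
    using Cons by simp
  show ?case
  proof (cases a)
    case a: (Inl v)
    show ?thesis
    proof (cases b)
      case b: (Inl v')
      then obtain r where r: "vwalk r (with_proj G)" "hd r = v'" "last r = w"
        "length r + 1 \<le> length (b # q)"
        using IH by auto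
      have "(v, v') \<in> parcs G"
        using arc a b by simp
      then have "vwalk (v # r) (with_proj G)"
        using r G.in_arcsD1 by (intro vwalk_consI) auto
      moreover have "r \<noteq> []"
        using r by (auto simp: vwalk_def)
      ultimately show ?thesis
        using r a by (auto intro!: exI[of _ "v # r"])
    next
      case b: (Inr c)
      obtain x where c: "c = (v, x)" and v: "v \<in> pverts G"
        using arc a b by (cases c) auto
      show ?thesis
      \<comment> \<open>For \<open>v = w\<close> the induction hypothesis is vacuous, but the
        one-vertex walk will do. Otherwise the walk it provides already starts at \<open>v\<close>
        and is reused as it is.\<close>
      proof (cases "v = w")
        case True
        then show ?thesis
          using a v by (auto intro!: exI[of _ "[v]"])
      next
        case False
        then show ?thesis
          using IH a b c by fastforce
      qed
    qed
  next
    case a: (Inr c)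
    show ?thesis
    proof (cases c)
      case c: (Pair v x)
      then show ?thesis
      proof (cases b)
        \<comment> \<open>The arc forces \<open>v' = v\<close>, so the walk is unchanged and
          \<open>a\<close> supplies the second extra vertex.\<close>
        case (Inl v')
        then show ?thesis
          using IH arc a c by fastforce
      next
        case (Inr d)
        then show ?thesis
          using IH arc a c by (cases d) fastforce
      qed
    qed
  qed
qed

text \<open>Every arc out of the copy at \<open>v\<close> ends in \<open>Inl v\<close>. The
  induction generalizes \<open>x\<close> because the walk may first wander inside the copy.\<close>

lemma vwalk_leaving_copy:
  assumes "vwalk q (with_proj (corona G H))" "hd q = Inr (v, x)"
    and "last q \<notin> Inr ` ({v} \<times> UNIV)"
  shows "Inl v \<in> set q"
  using assms
proof (induct q arbitrary: x)
  case (Base a)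
  then show ?case by auto
next
  case (Cons a b q)
  have arc: "(Inr (v, x), b) \<in> parcs (corona G H)"
    using Cons by simp
  show ?case
  proof (cases b)
    case (Inl u)
    then show ?thesis
      using arc by auto
  next
    case (Inr d)
    then obtain y where "b = Inr (v, y)"
      using arc by (cases d) auto
    then show ?thesis
      using Cons(2)[of y] Cons(3,4) by auto
  qed
qed

section \<open>Visibility between vertices of the copies\<close>

context
  fixes G :: "'a pair_pre_digraph" and H :: "'b pair_pre_digraph"
  assumes G: "pair_graph G" and H: "pair_graph H"
begin

interpretation G: pair_graph G by (fact G)

interpretation H: pair_graph H by (fact H)

text \<open>Distances within a copy are at most 2 in the corona: non-adjacent vertices have
  \<open>Inl v\<close> as a common neighbour, and it lies outside \<open>X\<close>.\<close>

lemma visible_same_copy: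
  assumes v: "v \<in> pverts G" and xy: "x \<in> pverts H" "y \<in> pverts H" "x \<noteq> y"
    and X: "Inl v \<notin> X"
  shows "visible (with_proj (corona G H)) X (Inr (v, x)) (Inr (v, y))"
proof -
  let ?C = "with_proj (corona G H)"
  let ?a = "Inr (v, x)" and ?b = "Inr (v, y)"
  have long: "2 \<le> length q" if "vpath q ?C" "hd q = ?a" "last q = ?b" for q
    using that xy by (cases q rule: vwalk_arcs.cases) auto
  show ?thesis
  proof (cases "(x, y) \<in> parcs H")
    case True
    then have "vpath [?a, ?b] ?C"
      using v xy by (auto simp: vpath_def vwalk_def pverts_corona)
    then have "shortest_vpath ?C ?a [?a, ?b] ?b"
      using long by (fastforce simp: shortest_vpath_def)
    then show ?thesis
      unfolding visible_def by (intro exI[of _ "[?a, ?b]"]) auto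
  next
    case False
    have "vpath [?a, Inl v, ?b] ?C"
      using v xy by (auto simp: vpath_def vwalk_def pverts_corona)
    moreover have "3 \<le> length q" if q: "vpath q ?C" "hd q = ?a" "last q = ?b" for q
    proof (rule ccontr)
      assume "\<not> 3 \<le> length q"
      with long[OF q] have "length q = Suc (Suc 0)"
        by simp
      with q have "q = [?a, ?b]"
        by (auto simp: length_Suc_conv)
      with q False show False
        by (auto simp: vpath_def vwalk_def)
    qed
    ultimately have "shortest_vpath ?C ?a [?a, Inl v, ?b] ?b"
      by (fastforce simp: shortest_vpath_def)
    then show ?thesis
      using X unfolding visible_def by (intro exI[of _ "[?a, Inl v, ?b]"]) auto
  qed
qed

text \<open>A shortest path of \<open>G\<close> from \<open>v\<close> to \<open>w\<close>, extended
  by one vertex at each end, is shortest in the corona by \<open>vwalk_corona_project\<close>; its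
  interior lies in \<open>range Inl\<close> and so avoids \<open>X\<close>.\<close>

lemma visible_different_copies:
  assumes con: "Digraph_Component.connected (with_proj G)"
    and vw: "v \<in> pverts G" "w \<in> pverts G" "v \<noteq> w" and xy: "x \<in> pverts H" "y \<in> pverts H"
    and X: "X \<inter> range Inl = {}"
  shows "visible (with_proj (corona G H)) X (Inr (v, x)) (Inr (w, y))"
proof -
  let ?C = "with_proj (corona G H)"
  let ?a = "Inr (v, x)" and ?b = "Inr (w, y)"
  obtain p0 where "vwalk p0 (with_proj G)" "hd p0 = v" "last p0 = w"
    using G.symmetric_connected_imp_strongly_connected[OF G.pair_sym_arcs con] vw
    by (auto simp: strongly_connected_def G.reachable_vwalk_conv)
  then obtain p where p: "vpath p (with_proj G)" "hd p = v" "last p = w"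
    and p_min: "\<And>r. vwalk r (with_proj G) \<Longrightarrow> hd r = v \<Longrightarrow> last r = w \<Longrightarrow> length p \<le> length r"
    by (rule shortest_vpath_exists) blast
  let ?p = "?a # map Inl p @ [?b]"
  have ne: "p \<noteq> []"
    using p by (auto simp: vpath_def vwalk_def)
  have arcs_map: "vwalk_arcs (map f r) = map (map_prod f f) (vwalk_arcs r)"
    for f :: "'a \<Rightarrow> 'a + 'a \<times> 'b" and r
    by (induct r rule: vwalk_arcs.induct) auto
  have "set (vwalk_arcs p) \<subseteq> parcs G" "set p \<subseteq> pverts G" "distinct p"
    using p by (auto simp: vpath_def vwalk_def)
  then have "vpath ?p ?C"
    using p ne vw xy
    by (auto simp: vpath_def vwalk_def pverts_corona vwalk_arcs_append arcs_map distinct_map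
        hd_map last_map)
  moreover have "length ?p \<le> length q" if q: "vpath q ?C" "hd q = ?a" "last q = ?b" for q
  proof -
    have "vwalk q ?C"
      using q by (simp add: vpath_def)
    from vwalk_corona_project[OF this q(3) G] obtain r where
      "vwalk r (with_proj G)" "hd r = v" "last r = w" "length r + 2 \<le> length q"
      using q(2) vw by auto
    then show ?thesis
      using p_min[of r] by simp
  qed
  ultimately have "shortest_vpath ?C ?a ?p ?b"
    by (fastforce simp: shortest_vpath_def)
  then show ?thesis
    using X unfolding visible_def by (intro exI[of _ ?p]) auto
qed

lemma mutual_visibility_set_copies:
  assumes con: "Digraph_Component.connected (with_proj G)"
  shows "mutual_visibility_set (with_proj (corona G H)) (Inr ` (pverts G \<times> pverts H))"
  unfolding mutual_visibility_set_def
proof (intro conjI ballI impI)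
  let ?X = "Inr ` (pverts G \<times> pverts H) :: ('a + 'a \<times> 'b) set"
  show "?X \<subseteq> verts (with_proj (corona G H))"
    by (auto simp: pverts_corona)
  fix a b
  assume "a \<in> ?X" "b \<in> ?X" "a \<noteq> b"
  then obtain v x w y where "a = Inr (v, x)" "b = Inr (w, y)" "v \<in> pverts G" "w \<in> pverts G"
    "x \<in> pverts H" "y \<in> pverts H" "v \<noteq> w \<or> x \<noteq> y"
    by auto
  then show "visible (with_proj (corona G H)) ?X a b"
    using visible_same_copy[of v x y ?X] visible_different_copies[OF con, of v w x y ?X]
    by (cases "v = w") auto
qed

section \<open>Sets containing a vertex of \<open>G\<close>\<close>

lemma mutual_visibility_set_cut_vertex:
  assumes X: "mutual_visibility_set (with_proj (corona G H)) X"
    and v: "Inl v \<in> X" "Inr (v, x) \<in> X"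
  shows "X \<subseteq> insert (Inl v) (Inr ` ({v} \<times> pverts H))"
proof
  fix b
  assume b: "b \<in> X"
  show "b \<in> insert (Inl v) (Inr ` ({v} \<times> pverts H))"
  proof (rule ccontr)
    assume *: "b \<notin> insert (Inl v) (Inr ` ({v} \<times> pverts H))"
    \<comment> \<open>Since \<open>b\<close> is a vertex of the corona, \<open>pverts H\<close> may
      be widened to \<open>UNIV\<close>, the form used in \<open>vwalk_leaving_copy\<close>.\<close>
    have "X \<subseteq> pverts (corona G H)"
      using X by (simp add: mutual_visibility_set_def)
    then have out: "b \<notin> Inr ` ({v} \<times> UNIV)" "b \<noteq> Inl v"
      using * b by (auto simp: pverts_corona)
    then have "Inr (v, x) \<noteq> b"
      by auto
    then have "visible (with_proj (corona G H)) X (Inr (v, x)) b"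
      using X b v by (simp add: mutual_visibility_set_def)
    then obtain p where p: "vwalk p (with_proj (corona G H))" "hd p = Inr (v, x)" "last p = b"
      "set p \<inter> X \<subseteq> {Inr (v, x), b}"
      by (auto simp: visible_def shortest_vpath_def vpath_def)
    \<comment> \<open>The path must pass through \<open>Inl v\<close>, which belongs to
      \<open>X\<close> and differs from both of its ends.\<close>
    then show False
      using vwalk_leaving_copy[OF p(1,2)] out v by auto
  qed
qed

lemma card_mutual_visibility_set_less:
  assumes card_G: "2 \<le> card (pverts G)" and card_H: "2 \<le> card (pverts H)"
    and X: "mutual_visibility_set (with_proj (corona G H)) X"
    and u: "Inl u \<in> X"
  shows "card X < card (pverts G) * card (pverts H)"
proof -
  let ?m = "card (pverts H)"
  have sub: "X \<subseteq> Inl ` pverts G \<union> Inr ` (pverts G \<times> pverts H)"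
    using X by (simp add: mutual_visibility_set_def pverts_corona)
  have fin: "finite (pverts G)" "finite (pverts H)"
    by (simp_all add: G.pair_finite_verts H.pair_finite_verts)
  show ?thesis
  proof (cases "\<exists>v x. Inl v \<in> X \<and> Inr (v, x) \<in> X")
    case True
    then obtain v where "X \<subseteq> insert (Inl v) (Inr ` ({v} \<times> pverts H))"
      using mutual_visibility_set_cut_vertex[OF X] by blast
    then have "card X \<le> card (insert (Inl v) (Inr ` ({v} \<times> pverts H)))"
      using fin by (intro card_mono) auto
    also have "\<dots> \<le> Suc ?m"
      using fin by (auto simp: card_insert_if card_image card_cartesian_product)
    also have "\<dots> < 2 * ?m"
      using card_H by simp
    also have "\<dots> \<le> card (pverts G) * ?m"
      using card_G by (rule mult_le_mono1)
    finally show ?thesis .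
  next
    case False
    \<comment> \<open>Each vertex in \<open>A\<close> excludes its whole copy from \<open>X\<close>,
      so it replaces at least two vertices by one; as \<open>A\<close> contains \<open>u\<close>,
      the loss is strict.\<close>
    define A where "A = {v. Inl v \<in> X}"
    have A: "A \<subseteq> pverts G" "u \<in> A"
      using sub u by (auto simp: A_def)
    then have fin_A: "finite A" and pos: "0 < card A"
      using fin by (auto intro: finite_subset simp: card_gt_0_iff)
    have "X \<subseteq> Inl ` A \<union> Inr ` ((pverts G - A) \<times> pverts H)"
      using sub False by (force simp: A_def)
    then have "card X \<le> card (Inl ` A \<union> Inr ` ((pverts G - A) \<times> pverts H) :: ('a + 'a \<times> 'b) set)"
      using fin fin_A by (intro card_mono) auto
    also have "\<dots> = card A + card (pverts G - A) * ?m"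
      using fin fin_A
      by (subst card_Un_disjoint) (auto simp: card_image card_cartesian_product)
    also have "\<dots> < card A * ?m + card (pverts G - A) * ?m"
      using card_H pos by simp
    also have "\<dots> = (card A + card (pverts G - A)) * ?m"
      by (simp add: algebra_simps)
    also have "card A + card (pverts G - A) = card (pverts G)"
      using A fin fin_A by (simp add: card_Diff_subset card_mono)
    finally show ?thesis .
  qed
qed

text \<open>The size hypothesis is an inequality so that the lemma gives both uniqueness in the top
  cardinality and the absence of larger sets.\<close>

lemma mutual_visibility_set_max:
  assumes "2 \<le> card (pverts G)" "2 \<le> card (pverts H)"
    and X: "mutual_visibility_set (with_proj (corona G H)) X"
    and card_X: "card (pverts G) * card (pverts H) \<le> card X"
  shows "X = Inr ` (pverts G \<times> pverts H)"
proof (rule card_seteq)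
  show "finite (Inr ` (pverts G \<times> pverts H) :: ('a + 'a \<times> 'b) set)"
    by (simp add: G.pair_finite_verts H.pair_finite_verts)
  have "Inl u \<notin> X" for u
    using card_mutual_visibility_set_less[OF assms(1-3), of u] card_X by auto
  then show "X \<subseteq> Inr ` (pverts G \<times> pverts H)"
    using X by (force simp: mutual_visibility_set_def pverts_corona)
  show "card (Inr ` (pverts G \<times> pverts H) :: ('a + 'a \<times> 'b) set) \<le> card X"
    using card_X by (simp add: card_image card_cartesian_product)
qed

end

section \<open>From the unique maximum set to the leading coefficient\<close>

theorem mainTheorem9:
  fixes G :: "'a pair_pre_digraph" and H :: "'b pair_pre_digraph"
  assumes "pair_graph G" and "Digraph_Component.connected (with_proj G)" and "card (pverts G) \<ge> 2"
    and "pair_graph H" and "Digraph_Component.connected (with_proj H)" and "card (pverts H) \<ge> 2"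
  shows "lead_coeff (visibility_poly (with_proj (corona G H))) = 1"
proof -
  let ?C = "with_proj (corona G H)"
  let ?X = "Inr ` (pverts G \<times> pverts H) :: ('a + 'a \<times> 'b) set"
  define N where "N = card (pverts G) * card (pverts H)"
  note max = mutual_visibility_set_max[OF assms(1,4,3,6), folded N_def]
  have card_X: "card ?X = N"
    by (simp add: N_def card_image card_cartesian_product)
  have mv_X: "mutual_visibility_set ?C ?X"
    using assms by (simp add: mutual_visibility_set_copies)
  interpret C: pair_graph "corona G H"
    using assms by (simp add: pair_graph_corona)
  have coeff: "coeff (visibility_poly ?C) i = int (mv_count ?C i)" for i
    by (rule coeff_visibility_poly) (simp add: C.pair_finite_verts)
  have "mutual_visibility_set ?C X \<and> card X = N \<longleftrightarrow> X = ?X" for X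
    using max[of X] mv_X card_X by (metis order_refl)
  then have "{X. mutual_visibility_set ?C X \<and> card X = N} = {?X}"
    by simp
  then have top: "coeff (visibility_poly ?C) N = 1"
    by (simp add: coeff mv_count_def)
  have "coeff (visibility_poly ?C) i = 0" if "N < i" for i
  proof -
    \<comment> \<open>By \<open>max\<close>, a set of size \<open>i\<close> above \<open>N\<close>
      would equal \<open>?X\<close>, whose size is only \<open>N\<close>.\<close>
    have "{X. mutual_visibility_set ?C X \<and> card X = i} = {}"
      using max card_X that by (metis (mono_tags, lifting) Collect_empty_eq less_imp_le less_irrefl)
    then show ?thesis
      unfolding coeff mv_count_def by (simp only: card.empty of_nat_0)
  qed
  then have "degree (visibility_poly ?C) = N"
    using top by (intro antisym degree_le le_degree) auto
  with top show ?thesis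
    by simp
qed

end
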